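(* Let $M=(E,\mathcal{I})$ be a matroid with rank $r_M(E)\geq 2$ and let $t$ be a positive integer. If there is a flat $F$ of $M$ satisfying $|E|-|F|<t\,(r_M(E)-r_M(F))$, then $ar(M,t)=|E|$. Otherwise, $$ar(M,t)=\max_{F\colon r_M(F)\leq r_M(E)-2}\{|F|+t\,(r_M(E)-r_M(F)-1)\},$$ where the maximum is taken over all flats $F$ of $M$ with $r_M(F)\leq r_M(E)-2$.
   Context: All matroids have finite ground sets. $r_M(S)$ denotes the rank of $S\subseteq E$ (maximum size of an independent subset of $S$). The closure of $S$ is $cl(S)=\{x\in E: r_M(S\cup\{x\})=r_M(S)\}$, and a flat is a set $F$ with $cl(F)=F$. A coloring of $E$ assigns a color to every element of $E$. A rainbow basis is a basis of $M$ whose elements receive pairwise different colors. Bases $B_1,\dots,B_t$ are pairwise disjoint if they are pairwise disjoint as subsets of $E$. The anti-Ramsey number $ar(M,t)$ is the maximum number $m$ such that there exists a coloring of $E$ using exactly $m$ colors which contains no $t$ pairwise disjoint rainbow bases. *)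

theory Defs
  imports Main "HOL-Library.Disjoint_Sets"
begin

definition matroid :: "'a set \<Rightarrow> 'a set set \<Rightarrow> bool" where
  "matroid E \<I> \<longleftrightarrow>
     finite E \<and>
     \<I> \<subseteq> Pow E \<and>
     {} \<in> \<I> \<and>
     (\<forall>X\<in>\<I>. \<forall>Y. Y \<subseteq> X \<longrightarrow> Y \<in> \<I>) \<and>
     (\<forall>X\<in>\<I>. \<forall>Y\<in>\<I>. card X < card Y \<longrightarrow> (\<exists>y\<in>Y - X. insert y X \<in> \<I>))"

definition rank :: "'a set set \<Rightarrow> 'a set \<Rightarrow> nat" where
  "rank \<I> S = Max (card ` {X \<in> \<I>. X \<subseteq> S})"

definition cl :: "'a set \<Rightarrow> 'a set set \<Rightarrow> 'a set \<Rightarrow> 'a set" where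
  "cl E \<I> S = {x \<in> E. rank \<I> (S \<union> {x}) = rank \<I> S}"

definition flat :: "'a set \<Rightarrow> 'a set set \<Rightarrow> 'a set \<Rightarrow> bool" where
  "flat E \<I> F \<longleftrightarrow> F \<subseteq> E \<and> cl E \<I> F = F"

definition basis :: "'a set set \<Rightarrow> 'a set \<Rightarrow> bool" where
  "basis \<I> B \<longleftrightarrow> B \<in> \<I> \<and> (\<forall>X\<in>\<I>. B \<subseteq> X \<longrightarrow> X = B)"

definition rainbow_basis :: "'a set set \<Rightarrow> ('a \<Rightarrow> 'c) \<Rightarrow> 'a set \<Rightarrow> bool" where
  "rainbow_basis \<I> c B \<longleftrightarrow> basis \<I> B \<and> inj_on c B"

text \<open>Only the individual bases have to be rainbow: a colour may occur in several of them.\<close>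

definition has_disjoint_rainbow_bases ::
    "'a set set \<Rightarrow> ('a \<Rightarrow> 'c) \<Rightarrow> nat \<Rightarrow> bool" where
  "has_disjoint_rainbow_bases \<I> c t \<longleftrightarrow>
     (\<exists>B. (\<forall>i<t. rainbow_basis \<I> c (B i)) \<and> disjoint_family_on B {..<t})"

text \<open>Since the ground set is finite, natural numbers suffice as colours. The set of attainable
  values is bounded by the size of \<^term>\<open>E\<close>; for \<^term>\<open>t \<ge> 1\<close> and rank at least 2 it is also
  nonempty (colour everything with one colour), so the maximum exists.\<close>

definition ar :: "'a set \<Rightarrow> 'a set set \<Rightarrow> nat \<Rightarrow> nat" where
  "ar E \<I> t =
     Max {m. \<exists>c :: 'a \<Rightarrow> nat. card (c ` E) = m \<and> \<not> has_disjoint_rainbow_bases \<I> c t}"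

end

theory Submission
  imports Defs
begin

text \<open>
  Write \<open>r\<close> for the rank function. If \<open>|E - F| < t (r E - r F)\<close> for some \<open>F\<close>, there are no \<open>t\<close>
  disjoint bases at all. Otherwise call \<open>U \<subseteq> E\<close> packable if \<open>|U - S| \<ge> t (r E - r S)\<close> for all
  \<open>S \<subseteq> U\<close>; by Rado's theorem such a set contains \<open>t\<close> disjoint bases. Given a colouring with too
  many colours, take \<open>U\<close> minimal among the packable sets that meet all colours. The sets \<open>S\<close>
  with equality in the packing condition are closed under intersection, so by minimality one such
  set \<open>F\<close> avoids every element of \<open>U\<close> whose colour occurs twice in \<open>U\<close>. The bound on the number of
  colours, applied to \<open>F\<close>, shows that \<open>U\<close> has at most \<open>t - 1\<close> more elements than colours. So \<open>t\<close>
  disjoint bases inside \<open>U\<close> contain at most \<open>2 (t - 1)\<close> elements of repeated colour. After one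
  symmetric exchange some basis contains exactly one of them; it is rainbow, and
  removing it leaves \<open>t - 1\<close> bases to which induction applies.
\<close>

section \<open>Rank, closure and exchange\<close>

locale finite_matroid =
  fixes E :: "'a set" and \<I> :: "'a set set"
  assumes mat: "matroid E \<I>"
begin

abbreviation r :: "'a set \<Rightarrow> nat" where "r \<equiv> rank \<I>"

lemma finite_E: "finite E"
  and indep_subset_E: "X \<in> \<I> \<Longrightarrow> X \<subseteq> E"
  and indep_empty: "{} \<in> \<I>"
  and indep_mono: "X \<in> \<I> \<Longrightarrow> Y \<subseteq> X \<Longrightarrow> Y \<in> \<I>"
  and indep_augment: "X \<in> \<I> \<Longrightarrow> Y \<in> \<I> \<Longrightarrow> card X < card Y \<Longrightarrow> \<exists>y\<in>Y - X. insert y X \<in> \<I>"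
  using mat unfolding matroid_def by blast+

lemma finite_indep: "X \<in> \<I> \<Longrightarrow> finite X"
  using finite_E indep_subset_E finite_subset by blast

lemma finite_family: "finite \<I>"
  using finite_E indep_subset_E by (meson PowI finite_Pow_iff finite_subset subsetI)

lemma card_le_rank: "X \<in> \<I> \<Longrightarrow> X \<subseteq> S \<Longrightarrow> card X \<le> r S"
  unfolding rank_def using finite_family by (intro Max_ge) auto

lemma rank_witness: obtains X where "X \<in> \<I>" "X \<subseteq> S" "card X = r S"
proof -
  have "r S \<in> card ` {X \<in> \<I>. X \<subseteq> S}"
    unfolding rank_def using finite_family indep_empty by (intro Max_in) auto
  then show ?thesis using that by auto
qed

lemma rank_mono: "S \<subseteq> S' \<Longrightarrow> r S \<le> r S'"
  by (metis card_le_rank rank_witness subset_trans)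

lemma rank_le_card: "finite S \<Longrightarrow> r S \<le> card S"
  by (metis card_mono rank_witness)

lemma rank_empty: "r {} = 0"
  using rank_le_card[of "{}"] by simp

lemma rank_indep: "X \<in> \<I> \<Longrightarrow> r X = card X"
  using card_le_rank[of X X] rank_le_card[of X] finite_indep by fastforce

lemma indep_if_card_le_rank: "finite X \<Longrightarrow> card X \<le> r X \<Longrightarrow> X \<in> \<I>"
  by (metis card_seteq rank_witness)

lemma extend_indep:
  assumes "X \<in> \<I>" "X \<subseteq> S"
  obtains Y where "Y \<in> \<I>" "X \<subseteq> Y" "Y \<subseteq> S" "card Y = r S"
proof -
  have "\<exists>Y\<in>\<I>. X \<subseteq> Y \<and> Y \<subseteq> S \<and> card Y = r S"
    using assms
  proof (induction "r S - card X" arbitrary: X rule: less_induct)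
    case less
    show ?case
    proof (cases "card X < r S")
      case True
      obtain Z where Z: "Z \<in> \<I>" "Z \<subseteq> S" "card Z = r S" by (rule rank_witness)
      then obtain y where y: "y \<in> Z - X" "insert y X \<in> \<I>"
        using indep_augment[of X Z] less.prems True by auto
      have "card (insert y X) = Suc (card X)"
        using y less.prems finite_indep by simp
      then have "r S - card (insert y X) < r S - card X" using True by simp
      from less.hyps[OF this] y Z less.prems show ?thesis by blast
    next
      case False
      then show ?thesis using less.prems card_le_rank[of X S] by auto
    qed
  qed
  then show ?thesis using that by blast
qed

text \<open>A maximum independent subset of \<open>X \<inter> Y\<close>, extended to one of
  \<open>X \<union> Y\<close>, meets \<open>X\<close> and \<open>Y\<close> in independent sets;
  counting these two parts gives the inequality.\<close>

lemma rank_submodular: "r (X \<union> Y) + r (X \<inter> Y) \<le> r X + r Y"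
proof -
  obtain A where A: "A \<in> \<I>" "A \<subseteq> X \<inter> Y" "card A = r (X \<inter> Y)" by (rule rank_witness)
  then have "A \<subseteq> X \<union> Y" by blast
  then obtain B where B: "B \<in> \<I>" "A \<subseteq> B" "B \<subseteq> X \<union> Y" "card B = r (X \<union> Y)"
    using A extend_indep by metis
  have fB: "finite B" using B finite_indep by blast
  have "B \<inter> X \<union> B \<inter> Y = B" using B by blast
  then have "card (B \<inter> X) + card (B \<inter> Y) = card B + card (B \<inter> X \<inter> (B \<inter> Y))"
    using fB card_Un_Int[of "B \<inter> X" "B \<inter> Y"] by simp
  moreover have "card A \<le> card (B \<inter> X \<inter> (B \<inter> Y))"
    using fB A B by (intro card_mono) auto
  moreover have "card (B \<inter> X) \<le> r X" "card (B \<inter> Y) \<le> r Y"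
    using B by (auto intro!: card_le_rank intro: indep_mono)
  ultimately show ?thesis using A B by linarith
qed

text \<open>By submodularity the elements of \<open>D\<close> can be added one at a time. Spanning
  arguments, for closures and for the exchange property, are run through this form.\<close>

lemma rank_Un_eq:
  assumes "finite D" "\<And>x. x \<in> D \<Longrightarrow> r (insert x A) = r A"
  shows "r (A \<union> D) = r A"
  using assms
proof (induction D rule: finite_induct)
  case (insert x D)
  have "r ((A \<union> D) \<union> insert x A) + r ((A \<union> D) \<inter> insert x A) \<le> r (A \<union> D) + r (insert x A)"
    by (rule rank_submodular)
  moreover have "r A \<le> r ((A \<union> D) \<inter> insert x A)" by (rule rank_mono) auto
  moreover have "(A \<union> D) \<union> insert x A = A \<union> insert x D" by auto
  moreover have "r A \<le> r (A \<union> insert x D)" by (rule rank_mono) auto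
  ultimately show ?case using insert by simp
qed simp

lemma subset_cl: "S \<subseteq> E \<Longrightarrow> S \<subseteq> cl E \<I> S"
  by (auto simp: cl_def insert_absorb)

lemma rank_cl: "S \<subseteq> E \<Longrightarrow> r (cl E \<I> S) = r S"
proof -
  assume "S \<subseteq> E"
  have "r (S \<union> cl E \<I> S) = r S"
    by (rule rank_Un_eq) (auto simp: cl_def finite_E)
  then show ?thesis using subset_cl[OF \<open>S \<subseteq> E\<close>] by (simp add: sup.absorb2)
qed

lemma flat_cl:
  assumes "S \<subseteq> E" shows "flat E \<I> (cl E \<I> S)"
proof -
  have "x \<in> cl E \<I> S" if "x \<in> E" "r (cl E \<I> S \<union> {x}) = r (cl E \<I> S)" for x
  proof -
    have "r (S \<union> {x}) \<le> r S"
      using rank_mono[of "S \<union> {x}" "cl E \<I> S \<union> {x}"] subset_cl rank_cl assms that by auto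
    moreover have "r S \<le> r (S \<union> {x})" by (rule rank_mono) auto
    ultimately show ?thesis using that by (simp add: cl_def)
  qed
  moreover have "cl E \<I> S \<subseteq> E" by (auto simp: cl_def)
  ultimately show ?thesis
    unfolding flat_def using subset_cl[of "cl E \<I> S"] by (auto simp: cl_def[of _ _ "cl E \<I> S"])
qed

lemma basis_iff: "basis \<I> B \<longleftrightarrow> B \<in> \<I> \<and> card B = r E"
proof
  assume B: "basis \<I> B"
  then have "B \<in> \<I>" "B \<subseteq> E" using indep_subset_E by (auto simp: basis_def)
  then obtain Y where "Y \<in> \<I>" "B \<subseteq> Y" "card Y = r E" by (metis extend_indep)
  then show "B \<in> \<I> \<and> card B = r E" using B by (auto simp: basis_def)
next
  assume B: "B \<in> \<I> \<and> card B = r E"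
  have "X = B" if "X \<in> \<I>" "B \<subseteq> X" for X
    using card_seteq[of X B] that B card_le_rank[of X E] indep_subset_E finite_indep by auto
  then show "basis \<I> B" using B by (auto simp: basis_def)
qed

lemma finite_basis: "basis \<I> B \<Longrightarrow> finite B"
  and basis_subset_E: "basis \<I> B \<Longrightarrow> B \<subseteq> E"
  and card_basis: "basis \<I> B \<Longrightarrow> card B = r E"
  using basis_iff finite_indep indep_subset_E by auto

lemma basisI: "finite B \<Longrightarrow> card B = r E \<Longrightarrow> r E \<le> r B \<Longrightarrow> basis \<I> B"
  using basis_iff indep_if_card_le_rank by simp

text \<open>A basis meets \<open>F\<close> in an independent set. This count underlies both ways of
  ruling out \<open>t\<close> disjoint rainbow bases.\<close>

lemma card_basis_diff:
  assumes "basis \<I> B"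
  shows "r E - r F \<le> card (B - F)"
proof -
  have "card (B \<inter> F) \<le> r F"
    using assms basis_iff by (intro card_le_rank) (auto intro: indep_mono)
  moreover have "card B = card (B \<inter> F) + card (B - F)"
    using card_Int_Diff[of B F] finite_basis[OF assms] by simp
  ultimately show ?thesis using card_basis[OF assms] by linarith
qed

text \<open>The element \<open>f\<close> is chosen in the fundamental circuit of \<open>e\<close>
  with respect to \<open>B2\<close>, outside the span of \<open>B1 - {e}\<close>; one such choice
  serves both exchanges.\<close>

lemma symmetric_exchange:
  assumes B1: "basis \<I> B1" and B2: "basis \<I> B2" and e: "e \<in> B1" "e \<notin> B2"
  obtains f where "f \<in> B2" "f \<notin> B1" "basis \<I> (insert f (B1 - {e}))" "basis \<I> (insert e (B2 - {f}))"
proof -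
  have fin: "finite B1" "finite B2" using B1 B2 finite_basis by auto
  have I1: "B1 \<in> \<I>" and I2: "B2 \<in> \<I>" using B1 B2 basis_iff by auto
  have cards: "card B1 = r E" "card B2 = r E" using B1 B2 card_basis by auto
  have eE: "e \<in> E" using I1 indep_subset_E e by auto
  have pos: "0 < card B1" using fin e card_gt_0_iff by blast
  \<comment> \<open>\<open>P D\<close> says that \<open>D\<close> spans \<open>e\<close>; a smallest
    such \<open>D\<close>, together with \<open>e\<close>, is the fundamental circuit.\<close>
  define P where "P D \<longleftrightarrow> D \<subseteq> B2 \<and> r (insert e D) = r D" for D
  have "r (insert e B2) \<le> r B2"
    using rank_mono[of "insert e B2" E] rank_indep[OF I2] cards eE indep_subset_E[OF I2] by simp
  moreover have "r B2 \<le> r (insert e B2)" by (rule rank_mono) auto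
  ultimately have "P B2" by (simp add: P_def)
  then obtain D where D: "P D" and Dmin: "\<And>D'. P D' \<Longrightarrow> card D \<le> card D'"
    using ex_has_least_nat[of P B2 card] by blast
  have D2: "D \<subseteq> B2" "finite D" using D fin finite_subset by (auto simp: P_def)
  have ID: "D \<in> \<I>" using D2 I2 indep_mono by blast
  have I1e: "B1 - {e} \<in> \<I>" using I1 indep_mono by blast
  have c1e: "card (B1 - {e}) = r E - 1" using e fin cards by simp
  \<comment> \<open>Otherwise \<open>B1 - {e}\<close> would span \<open>D\<close>, hence also
    \<open>e\<close>, and so have full rank.\<close>
  have "\<exists>f\<in>D. r (insert f (B1 - {e})) \<noteq> r (B1 - {e})"
  proof (rule ccontr)
    assume "\<not> ?thesis"
    then have "r ((B1 - {e}) \<union> D) = r (B1 - {e})" using D2 by (intro rank_Un_eq) auto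
    moreover have "r ((B1 - {e}) \<union> D \<union> insert e D) + r (((B1 - {e}) \<union> D) \<inter> insert e D)
        \<le> r ((B1 - {e}) \<union> D) + r (insert e D)" by (rule rank_submodular)
    moreover have "r D \<le> r (((B1 - {e}) \<union> D) \<inter> insert e D)" by (rule rank_mono) auto
    moreover have "r B1 \<le> r ((B1 - {e}) \<union> D \<union> insert e D)" by (rule rank_mono) auto
    ultimately have "r B1 \<le> r (B1 - {e})" using D by (simp add: P_def)
    then show False using rank_indep[OF I1] rank_indep[OF I1e] c1e cards pos by simp
  qed
  then obtain f where f: "f \<in> D" "r (insert f (B1 - {e})) \<noteq> r (B1 - {e})" by blast
  have fB2: "f \<in> B2" using f D2 by blast
  have fne: "f \<noteq> e" using fB2 e by auto
  have f1: "f \<notin> B1 - {e}" using f by (metis insert_absorb)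
  have "r (B1 - {e}) < r (insert f (B1 - {e}))"
    using f(2) rank_mono[OF subset_insertI[of "B1 - {e}" f]] by linarith
  then have "r E \<le> r (insert f (B1 - {e}))" using rank_indep[OF I1e] c1e by simp
  moreover have "card (insert f (B1 - {e})) = r E"
    using f1 fin c1e cards pos by simp
  ultimately have b1: "basis \<I> (insert f (B1 - {e}))" using fin by (intro basisI) auto
  have I2f: "B2 - {f} \<in> \<I>" "D - {f} \<in> \<I>" using I2 ID indep_mono by blast+
  have c2f: "card (B2 - {f}) = r E - 1" using fB2 fin cards by simp
  have cD: "card (D - {f}) < card D" using f D2 by (meson card_Diff1_less)
  \<comment> \<open>If this failed, submodularity would make \<open>D - {f}\<close> span
    \<open>e\<close>, against the minimality of \<open>D\<close>.\<close>
  have "r E \<le> r (insert e (B2 - {f}))"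
  proof (rule ccontr)
    assume "\<not> ?thesis"
    then have small: "r (insert e (B2 - {f})) \<le> r E - 1" by linarith
    have "insert e (B2 - {f}) \<inter> insert e D = insert e (D - {f})" using D2 fne by auto
    then have "r (insert e (B2 - {f}) \<union> insert e D) + r (insert e (D - {f}))
        \<le> r (insert e (B2 - {f})) + r (insert e D)"
      using rank_submodular[of "insert e (B2 - {f})" "insert e D"] by simp
    moreover have "r B2 \<le> r (insert e (B2 - {f}) \<union> insert e D)" using f by (intro rank_mono) auto
    moreover have "r B2 = r E" using rank_indep[OF I2] cards by simp
    moreover have "r (insert e D) = card D" using D rank_indep[OF ID] by (simp add: P_def)
    ultimately have "r (insert e (D - {f})) + 1 \<le> card D" using small pos cards by linarith
    then have "r (insert e (D - {f})) \<le> r (D - {f})"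
      using rank_indep[OF I2f(2)] f D2 by simp
    moreover have "r (D - {f}) \<le> r (insert e (D - {f}))" by (rule rank_mono) auto
    ultimately have "P (D - {f})" using D2 by (auto simp: P_def)
    then show False using Dmin cD by fastforce
  qed
  moreover have "card (insert e (B2 - {f})) = r E" using e fin c2f cards pos by simp
  ultimately have b2: "basis \<I> (insert e (B2 - {f}))" using fin by (intro basisI) auto
  show ?thesis using that[OF fB2 _ b1 b2] f1 fne by blast
qed

end

section \<open>Packing bases\<close>

text \<open>Rado's theorem. A minimal system of sets satisfying the rank condition consists of
  singletons: if deleting either of two elements of one set destroys the condition, the two
  violating subfamilies contradict submodularity.\<close>

lemma rado_submodular:
  fixes \<rho> :: "'b set \<Rightarrow> nat" and A :: "'a \<Rightarrow> 'b set"
  assumes mono: "\<And>P Q. P \<subseteq> Q \<Longrightarrow> \<rho> P \<le> \<rho> Q"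
    and submod: "\<And>P Q. \<rho> (P \<union> Q) + \<rho> (P \<inter> Q) \<le> \<rho> P + \<rho> Q"
    and empty: "\<rho> {} = 0"
    and fin: "finite U" "\<And>x. x \<in> U \<Longrightarrow> finite (A x)"
    and rado: "\<And>X. X \<subseteq> U \<Longrightarrow> card X \<le> \<rho> (\<Union>x\<in>X. A x)"
  shows "\<exists>f. (\<forall>x\<in>U. f x \<in> A x) \<and> (\<forall>X\<subseteq>U. card X \<le> \<rho> (f ` X))"
  using fin(2) rado
proof (induction "\<Sum>x\<in>U. card (A x)" arbitrary: A rule: less_induct)
  case less
  have ne: "A x \<noteq> {}" if "x \<in> U" for x
    using less.prems(2)[of "{x}"] that empty by auto
  show ?case
  proof (cases "\<forall>x\<in>U. is_singleton (A x)")
    case True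
    have sing: "A x = {the_elem (A x)}" if "x \<in> U" for x
      using True that is_singleton_the_elem by metis
    define f where "f x = the_elem (A x)" for x
    have Af: "A x = {f x}" if "x \<in> U" for x using sing[OF that] by (simp add: f_def)
    have "(\<Union>x\<in>X. A x) = f ` X" if "X \<subseteq> U" for X
      using Af that by auto
    then have "\<forall>X\<subseteq>U. card X \<le> \<rho> (f ` X)" using less.prems(2) by metis
    then show ?thesis using Af by (intro exI[of _ f]) auto
  next
    case False
    then obtain e where e: "e \<in> U" "\<not> is_singleton (A e)" by blast
    then obtain a b where ab: "a \<in> A e" "b \<in> A e" "a \<noteq> b"
      using ne[OF e(1)] by (metis is_singletonI')
    define A' where "A' z = A(e := A e - {z})" for z
    have IH: ?thesis if z: "z \<in> A e" and ok: "\<And>X. X \<subseteq> U \<Longrightarrow> card X \<le> \<rho> (\<Union>x\<in>X. A' z x)" for z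
    proof -
      have fin': "finite (A' z x)" if "x \<in> U" for x
        using less.prems(1) e(1) that by (simp add: A'_def)
      have "(\<Sum>x\<in>U. card (A' z x)) < (\<Sum>x\<in>U. card (A x))"
      proof (rule sum_strict_mono_ex1)
        show "\<forall>x\<in>U. card (A' z x) \<le> card (A x)"
          using less.prems(1) by (auto simp: A'_def intro!: card_mono)
        show "\<exists>x\<in>U. card (A' z x) < card (A x)"
          using e(1) card_Diff1_less[OF less.prems(1)[OF e(1)] z]
          by (intro bexI[of _ e]) (simp_all add: A'_def)
      qed (rule fin(1))
      from less.hyps[OF this fin' ok] obtain f
        where f: "\<forall>x\<in>U. f x \<in> A' z x" "\<forall>X\<subseteq>U. card X \<le> \<rho> (f ` X)" by blast
      then have "\<forall>x\<in>U. f x \<in> A x" by (auto simp: A'_def split: if_splits)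
      then show ?thesis using f by blast
    qed
    show ?thesis
    proof (rule ccontr)
      assume contra: "\<not> ?thesis"
      have viol: "\<exists>X\<subseteq>U - {e}. \<rho> ((\<Union>x\<in>X. A x) \<union> (A e - {z})) \<le> card X" if z: "z \<in> A e" for z
      proof -
        obtain X where X: "X \<subseteq> U" "\<rho> (\<Union>x\<in>X. A' z x) < card X"
          using IH[OF z] contra by (meson not_le_imp_less)
        \<comment> \<open>A violating family must involve \<open>e\<close>, because no other set has
          changed.\<close>
        have eX: "e \<in> X"
        proof (rule ccontr)
          assume "e \<notin> X"
          then have "(\<Union>x\<in>X. A' z x) = (\<Union>x\<in>X. A x)" by (auto simp: A'_def)
          then show False using X less.prems(2)[of X] by simp
        qed
        have "(\<Union>x\<in>X. A' z x) = (\<Union>x\<in>X - {e}. A x) \<union> (A e - {z})"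
          using eX by (auto simp: A'_def split: if_splits)
        moreover have "card X = Suc (card (X - {e}))"
          using eX X fin(1) by (metis card_Suc_Diff1 finite_subset)
        ultimately show ?thesis using X by (intro exI[of _ "X - {e}"]) auto
      qed
      obtain X where X: "X \<subseteq> U - {e}" "\<rho> ((\<Union>x\<in>X. A x) \<union> (A e - {a})) \<le> card X"
        using viol ab by blast
      obtain Y where Y: "Y \<subseteq> U - {e}" "\<rho> ((\<Union>x\<in>Y. A x) \<union> (A e - {b})) \<le> card Y"
        using viol ab by blast
      let ?P = "(\<Union>x\<in>X. A x) \<union> (A e - {a})" and ?Q = "(\<Union>x\<in>Y. A x) \<union> (A e - {b})"
      have finXY: "finite X" "finite Y" using X Y fin(1) finite_subset by blast+
      have "insert e (X \<union> Y) \<subseteq> U" using X Y e by blast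
      then have "card (insert e (X \<union> Y)) \<le> \<rho> (\<Union>x\<in>insert e (X \<union> Y). A x)"
        by (rule less.prems(2))
      \<comment> \<open>As \<open>a \<noteq> b\<close>, the two reduced copies of \<open>A e\<close>
        together restore \<open>A e\<close>. The union thus accounts for the extra index
        \<open>e\<close>, which is the excess of one in the contradiction.\<close>
      also have "(\<Union>x\<in>insert e (X \<union> Y). A x) = ?P \<union> ?Q" using ab by auto
      finally have "card (insert e (X \<union> Y)) \<le> \<rho> (?P \<union> ?Q)" .
      moreover have "card (insert e (X \<union> Y)) = Suc (card (X \<union> Y))"
        using finXY X Y by (intro card_insert_disjoint) auto
      moreover have "card (X \<inter> Y) \<le> \<rho> (\<Union>x\<in>X \<inter> Y. A x)"
        using less.prems(2)[of "X \<inter> Y"] X by blast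
      moreover have "\<rho> (\<Union>x\<in>X \<inter> Y. A x) \<le> \<rho> (?P \<inter> ?Q)" by (rule mono) auto
      moreover have "card X + card Y = card (X \<union> Y) + card (X \<inter> Y)"
        using finXY by (rule card_Un_Int)
      ultimately show False using submod[of ?P ?Q] X(2) Y(2) by linarith
    qed
  qed
qed

lemma finite_minimal_subset:
  assumes "finite U" "P U"
  obtains V where "V \<subseteq> U" "P V" "\<And>e. e \<in> V \<Longrightarrow> \<not> P (V - {e})"
proof -
  obtain V where V: "V \<subseteq> U \<and> P V" "\<And>W. W \<subseteq> U \<and> P W \<Longrightarrow> card V \<le> card W"
    using ex_has_least_nat[of "\<lambda>V. V \<subseteq> U \<and> P V" U card] assms by blast
  have "\<not> P (V - {e})" if "e \<in> V" for e
    using V(2)[of "V - {e}"] V(1) that card_Diff1_less[of V e] finite_subset[of V U] assms(1) by auto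
  then show ?thesis using that V by blast
qed

context finite_matroid
begin

text \<open>This is Rado's theorem for the direct sum of \<open>t\<close> copies of the matroid:
  each \<open>x\<close> selects one of its \<open>t\<close> copies, and the elements selecting copy
  \<open>i\<close> form part \<open>i\<close>.\<close>

lemma partition_into_indep:
  assumes "finite U" "\<And>X. X \<subseteq> U \<Longrightarrow> card X \<le> t * r X"
  shows "\<exists>f. (\<forall>x\<in>U. f x < t) \<and> (\<forall>i<t. {x \<in> U. f x = i} \<in> \<I>)"
proof -
  \<comment> \<open>The rank function of that direct sum.\<close>
  define \<rho> where "\<rho> P = (\<Sum>i<t. r {x. (x, i) \<in> P})" for P :: "('a \<times> nat) set"
  have "\<exists>f. (\<forall>x\<in>U. f x \<in> {x} \<times> {..<t}) \<and> (\<forall>X\<subseteq>U. card X \<le> \<rho> (f ` X))"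
  proof (rule rado_submodular)
    show "\<rho> P \<le> \<rho> Q" if "P \<subseteq> Q" for P Q
      unfolding \<rho>_def using that by (intro sum_mono rank_mono) auto
    show "\<rho> (P \<union> Q) + \<rho> (P \<inter> Q) \<le> \<rho> P + \<rho> Q" for P Q
    proof -
      have "{x. (x, i) \<in> P \<union> Q} = {x. (x, i) \<in> P} \<union> {x. (x, i) \<in> Q}"
        "{x. (x, i) \<in> P \<inter> Q} = {x. (x, i) \<in> P} \<inter> {x. (x, i) \<in> Q}" for i by auto
      then show ?thesis
        unfolding \<rho>_def sum.distrib[symmetric] by (intro sum_mono) (simp add: rank_submodular)
    qed
    show "\<rho> {} = 0" by (simp add: \<rho>_def rank_empty)
    show "card X \<le> \<rho> (\<Union>x\<in>X. {x} \<times> {..<t})" if "X \<subseteq> U" for X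
    proof -
      have "\<rho> (\<Union>x\<in>X. {x} \<times> {..<t}) = (\<Sum>i<t. r X)"
        unfolding \<rho>_def by (intro sum.cong refl arg_cong[of _ _ r]) auto
      then show ?thesis using assms(2)[OF that] by simp
    qed
  qed (use assms in auto)
  then obtain f where f: "\<And>x. x \<in> U \<Longrightarrow> f x \<in> {x} \<times> {..<t}"
    "\<And>X. X \<subseteq> U \<Longrightarrow> card X \<le> \<rho> (f ` X)" by blast
  have "{x \<in> U. snd (f x) = i} \<in> \<I>" if "i < t" for i
  proof (rule indep_if_card_le_rank)
    let ?X = "{x \<in> U. snd (f x) = i}"
    have "f x = (x, i)" if "x \<in> ?X" for x using f(1)[of x] that by (cases "f x") auto
    then have "f ` ?X = (\<lambda>x. (x, i)) ` ?X" by (rule image_cong[OF refl])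
    then have "f ` ?X = ?X \<times> {i}" by auto
    \<comment> \<open>The image lies in copy \<open>i\<close> alone, so only one summand
      survives.\<close>
    then have "\<rho> (f ` ?X) = (\<Sum>j<t. if j = i then r ?X else 0)"
      unfolding \<rho>_def by (intro sum.cong) (auto simp: rank_empty)
    also have "\<dots> = r ?X" using that by simp
    finally show "card ?X \<le> r ?X" using f(2)[of ?X] by auto
    show "finite ?X" using assms(1) by simp
  qed
  moreover have "\<forall>x\<in>U. snd (f x) < t" using f(1) by fastforce
  ultimately show ?thesis by (intro exI[of _ "\<lambda>x. snd (f x)"]) blast
qed

text \<open>Edmonds' condition for \<open>t\<close> disjoint bases inside \<open>U\<close>. Since
  \<open>S \<subseteq> E\<close>, the subtraction of ranks is never truncated. For positive
  \<open>t\<close>, the case \<open>S = U\<close> forces \<open>U\<close> to have full rank.\<close>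

definition packable :: "nat \<Rightarrow> 'a set \<Rightarrow> bool" where
  "packable t U \<longleftrightarrow> U \<subseteq> E \<and> (\<forall>S\<subseteq>U. t * (r E - r S) \<le> card (U - S))"

text \<open>The left-hand side is modular in \<open>S\<close> and the right-hand side supermodular,
  so adding the two equalities leaves no slack at the union or the intersection.\<close>

lemma tight_Int:
  assumes U: "packable t U" and "S \<subseteq> U" "S' \<subseteq> U"
    and "card (U - S) = t * (r E - r S)" "card (U - S') = t * (r E - r S')"
  shows "card (U - (S \<inter> S')) = t * (r E - r (S \<inter> S'))"
proof -
  have finU: "finite U" using U finite_E finite_subset by (auto simp: packable_def)
  have le: "r X \<le> r E" if "X \<subseteq> U" for X
    using that U by (intro rank_mono) (auto simp: packable_def)
  have "(U - S) \<union> (U - S') = U - (S \<inter> S')" "(U - S) \<inter> (U - S') = U - (S \<union> S')" by auto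
  then have "card (U - S) + card (U - S') = card (U - (S \<inter> S')) + card (U - (S \<union> S'))"
    using finU card_Un_Int[of "U - S" "U - S'"] by simp
  moreover have "t * (r E - r (S \<union> S')) \<le> card (U - (S \<union> S'))"
    "t * (r E - r (S \<inter> S')) \<le> card (U - (S \<inter> S'))"
    using U assms(2,3) unfolding packable_def by (meson Un_least le_infI1)+
  moreover have "t * (r E - r S) + t * (r E - r S') \<le>
      t * (r E - r (S \<union> S')) + t * (r E - r (S \<inter> S'))"
  proof -
    have "(r E - r S) + (r E - r S') \<le> (r E - r (S \<union> S')) + (r E - r (S \<inter> S'))"
      using rank_submodular[of S S'] le[of S] le[of S'] le[of "S \<union> S'"] le[of "S \<inter> S'"] assms(2,3)
      by auto
    then show ?thesis by (metis distrib_left mult_le_mono2)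
  qed
  ultimately show ?thesis using assms(4,5) by linarith
qed

text \<open>Each \<open>e\<close> in \<open>N\<close> contributes a tight set that misses it, and
  the intersection of these sets is again tight; it starts from \<open>U\<close>, which is itself
  tight.\<close>

lemma tight_set_avoiding:
  assumes U: "packable t U" and "N \<subseteq> U" and N: "\<And>e. e \<in> N \<Longrightarrow> \<not> packable t (U - {e})"
  obtains F where "F \<subseteq> U" "F \<inter> N = {}" "card (U - F) = t * (r E - r F)"
proof -
  have finU: "finite U" using U finite_E finite_subset by (auto simp: packable_def)
  have "finite N" using finU assms(2) finite_subset by blast
  then have "\<exists>F\<subseteq>U. F \<inter> N = {} \<and> card (U - F) = t * (r E - r F)"
    using assms(2) N
  proof (induction N rule: finite_induct)
    case empty
    have "t * (r E - r U) \<le> card (U - U)" using U unfolding packable_def by blast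
    then show ?case by (intro exI[of _ U]) auto
  next
    case (insert e N)
    then obtain F where F: "F \<subseteq> U" "F \<inter> N = {}" "card (U - F) = t * (r E - r F)" by auto
    have "\<not> packable t (U - {e})" "U - {e} \<subseteq> E" using insert.prems U by (auto simp: packable_def)
    then obtain S where S: "S \<subseteq> U - {e}" "card (U - {e} - S) < t * (r E - r S)"
      unfolding packable_def by (meson not_le_imp_less)
    have "U - {e} - S = (U - S) - {e}" by auto
    moreover have "e \<in> U - S" using insert.prems S by auto
    ultimately have "card (U - S) = Suc (card (U - {e} - S))"
      using finU by (metis card_Suc_Diff1 finite_Diff)
    moreover have "S \<subseteq> U" using S by auto
    moreover have "t * (r E - r S) \<le> card (U - S)" using U \<open>S \<subseteq> U\<close> by (auto simp: packable_def)
    \<comment> \<open>Deleting the single element \<open>e\<close> breaks the inequality at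
      \<open>S\<close>, so in \<open>U\<close> it holds with equality.\<close>
    ultimately have "card (U - S) = t * (r E - r S)" using S by linarith
    then have "card (U - (F \<inter> S)) = t * (r E - r (F \<inter> S))"
      using tight_Int[OF U F(1) \<open>S \<subseteq> U\<close>] F by blast
    then show ?case using F S by (intro exI[of _ "F \<inter> S"]) auto
  qed
  then show ?thesis using that by blast
qed

text \<open>In a minimal packable subset \<open>V\<close> no element can be spared, so some tight
  set avoids all of \<open>V\<close>. It is empty, which fixes the size of \<open>V\<close> at
  \<open>t * r E\<close> and allows a partition into bases.\<close>

lemma disjoint_bases_if_packable:
  assumes "packable t U"
  shows "\<exists>B. (\<forall>i<t. basis \<I> (B i) \<and> B i \<subseteq> U) \<and> disjoint_family_on B {..<t}"
proof -
  have finU: "finite U" using assms finite_E finite_subset by (auto simp: packable_def)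
  obtain V where V: "V \<subseteq> U" "packable t V" "\<And>e. e \<in> V \<Longrightarrow> \<not> packable t (V - {e})"
    using finite_minimal_subset[of U "packable t"] assms finU by blast
  have finV: "finite V" using V finU finite_subset by blast
  obtain F where "F \<subseteq> V" "F \<inter> V = {}" "card (V - F) = t * (r E - r F)"
    using tight_set_avoiding[OF V(2) subset_refl V(3)] by blast
  moreover from this have "F = {}" by blast
  ultimately have cV: "card V = t * r E" by (simp add: rank_empty)
  \<comment> \<open>With the size of \<open>V\<close> known, the packing condition on complements
    becomes the partition condition.\<close>
  have "card X \<le> t * r X" if "X \<subseteq> V" for X
  proof -
    have "t * (r E - r X) \<le> card (V - X)" using V that by (auto simp: packable_def)
    moreover have "card V = card X + card (V - X)"
      using that finV by (metis card_Diff_subset card_mono finite_subset le_add_diff_inverse)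
    moreover have "r X \<le> r E" using V that by (intro rank_mono) (auto simp: packable_def)
    ultimately show ?thesis using cV by (simp add: diff_mult_distrib2)
  qed
  then obtain f where f: "\<forall>x\<in>V. f x < t" "\<forall>i<t. {x \<in> V. f x = i} \<in> \<I>"
    using partition_into_indep[OF finV] by blast
  define B where "B i = {x \<in> V. f x = i}" for i
  have disj: "disjoint_family_on B {..<t}" by (auto simp: disjoint_family_on_def B_def)
  have le: "card (B i) \<le> r E" if "i < t" for i
    using f that indep_subset_E by (intro card_le_rank) (auto simp: B_def)
  have "(\<Union>i<t. B i) = V" using f by (auto simp: B_def)
  moreover have "card (\<Union>i<t. B i) = (\<Sum>i<t. card (B i))"
    using disj finV by (intro card_UN_disjoint') (simp_all add: B_def[abs_def])
  ultimately have "card V = (\<Sum>i<t. card (B i))" by simp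
  then have sum: "(\<Sum>i<t. card (B i)) = (\<Sum>i<t. r E)" using cV by simp
  \<comment> \<open>No part exceeds \<open>r E\<close> and the total is \<open>t * r E\<close>, so
    no part falls short.\<close>
  have "card (B i) = r E" if "i < t" for i
    by (rule sum_mono_inv[OF sum]) (use le that in auto)
  then have "\<forall>i<t. basis \<I> (B i) \<and> B i \<subseteq> U" using f V by (auto simp: basis_iff B_def)
  then show ?thesis using disj by blast
qed

end

section \<open>Rainbow bases\<close>

definition repeated :: "('a \<Rightarrow> 'c) \<Rightarrow> 'a set \<Rightarrow> 'a set" where
  "repeated c U = {x \<in> U. \<exists>y\<in>U. y \<noteq> x \<and> c y = c x}"

text \<open>Let \<open>R\<close> contain one representative of each colour. The repeated elements
  outside \<open>R\<close> lie in \<open>U - R\<close>, and each repeated representative shares its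
  colour with an element of \<open>U - R\<close>; either kind numbers at most
  \<open>card (U - R)\<close>.\<close>

lemma card_repeated_le:
  assumes "finite U"
  shows "card (repeated c U) + 2 * card (c ` U) \<le> 2 * card U"
proof -
  define R where "R = inv_into U c ` c ` U"
  have RU: "R \<subseteq> U" by (auto simp: R_def inv_into_into)
  have finR: "finite R" using RU assms finite_subset by blast
  have cR: "card R = card (c ` U)" unfolding R_def by (intro card_image inj_on_inv_into) auto
  have injR: "inj_on c R" by (auto simp: R_def inj_on_def f_inv_into_f)
  have "c ` (repeated c U \<inter> R) \<subseteq> c ` (U - R)"
  proof
    fix k assume "k \<in> c ` (repeated c U \<inter> R)"
    then obtain x y where xy: "x \<in> R" "y \<in> U" "y \<noteq> x" "c y = c x" "k = c x"
      by (auto simp: repeated_def)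
    then have "y \<notin> R" using injR by (auto simp: inj_on_def)
    then show "k \<in> c ` (U - R)" using xy by (intro image_eqI[of _ _ y]) auto
  qed
  then have "card (c ` (repeated c U \<inter> R)) \<le> card (U - R)"
    using assms by (meson card_image_le card_mono finite_Diff finite_imageI le_trans)
  moreover have "card (c ` (repeated c U \<inter> R)) = card (repeated c U \<inter> R)"
    by (rule card_image, rule inj_on_subset[OF injR]) auto
  moreover have finT: "finite (repeated c U)" using assms by (auto simp: repeated_def)
  moreover have "card (repeated c U) = card (repeated c U \<inter> R) + card (repeated c U - R)"
    using finT card_Int_Diff by blast
  moreover have "card (repeated c U - R) \<le> card (U - R)"
    using assms by (intro card_mono) (auto simp: repeated_def)
  moreover have "card U = card R + card (U - R)"
    using RU assms finR by (metis card_Diff_subset card_mono le_add_diff_inverse)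
  ultimately show ?thesis using cR by linarith
qed

text \<open>Each deleted element removes at most one colour. This carries the surplus bound over to
  the union of the packed bases.\<close>

lemma card_surplus_mono:
  assumes "finite V" "U \<subseteq> V"
  shows "card U + card (c ` V) \<le> card V + card (c ` U)"
proof -
  have "c ` V \<subseteq> c ` U \<union> c ` (V - U)" by auto
  then have "card (c ` V) \<le> card (c ` U) + card (c ` (V - U))"
    using assms by (meson card_Un_le card_mono finite_Diff finite_UnI finite_imageI finite_subset le_trans)
  moreover have "card (c ` (V - U)) \<le> card (V - U)" using assms by (intro card_image_le) auto
  moreover have "card V = card U + card (V - U)"
    using assms by (metis card_Diff_subset card_mono finite_subset le_add_diff_inverse)
  ultimately show ?thesis by linarith
qed

context finite_matroid
begin

text \<open>The repeated elements number at most \<^term>\<open>2 * (card I - 1)\<close>, so some basis contains at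
  most one of them; if it contains none, a symmetric exchange brings in exactly one.\<close>

lemma exists_family_with_single_repeated:
  fixes B :: "'i \<Rightarrow> 'a set"
  assumes "finite I" "\<And>i. i \<in> I \<Longrightarrow> basis \<I> (B i)" "disjoint_family_on B I"
    and surplus: "card (\<Union>i\<in>I. B i) < card (c ` (\<Union>i\<in>I. B i)) + card I"
    and rep: "repeated c (\<Union>i\<in>I. B i) \<noteq> {}"
  obtains B' i where "\<And>i. i \<in> I \<Longrightarrow> basis \<I> (B' i)" "disjoint_family_on B' I"
    "(\<Union>i\<in>I. B' i) = (\<Union>i\<in>I. B i)" "i \<in> I" "card (repeated c (\<Union>i\<in>I. B i) \<inter> B' i) = 1"
proof -
  define U where "U = (\<Union>i\<in>I. B i)"
  define T where "T = repeated c U"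
  have finU: "finite U" using assms(1,2) finite_basis by (auto simp: U_def)
  have TU: "T \<subseteq> U" by (auto simp: T_def repeated_def)
  have finT: "finite T" using TU finU finite_subset by blast
  have "card T < 2 * card I"
    using card_repeated_le[OF finU, of c] surplus unfolding T_def U_def by linarith
  moreover have "card T = (\<Sum>i\<in>I. card (T \<inter> B i))"
  proof -
    have "(\<Union>i\<in>I. T \<inter> B i) = T" using TU by (auto simp: U_def)
    moreover have "card (\<Union>i\<in>I. T \<inter> B i) = (\<Sum>i\<in>I. card (T \<inter> B i))"
      using assms(1,3) finT by (intro card_UN_disjoint') (auto simp: disjoint_family_on_def)
    ultimately show ?thesis by simp
  qed
  moreover have "card I * 2 \<le> (\<Sum>i\<in>I. card (T \<inter> B i))" if "\<forall>i\<in>I. 2 \<le> card (T \<inter> B i)"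
    using sum_bounded_below[of I 2 "\<lambda>i. card (T \<inter> B i)"] that by simp
  ultimately obtain i where i: "i \<in> I" "card (T \<inter> B i) < 2" by fastforce
  show ?thesis
  proof (cases "card (T \<inter> B i) = 1")
    case True
    then show ?thesis using that[of B i] assms i by (auto simp: T_def U_def)
  next
    case False
    then have "card (T \<inter> B i) = 0" using i by linarith
    then have Ti: "T \<inter> B i = {}" using finT by simp
    have "T \<noteq> {}" using rep by (simp add: T_def U_def)
    then obtain e j where e: "e \<in> T" "j \<in> I" "e \<in> B j"
      using TU unfolding U_def by blast
    have ij: "i \<noteq> j" using e Ti by auto
    have disj: "B k \<inter> B l = {}" if "k \<in> I" "l \<in> I" "k \<noteq> l" for k l
      using assms(3) that by (auto simp: disjoint_family_on_def)
    have "e \<notin> B i" using e Ti by auto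
    then obtain f where f: "f \<in> B i" "f \<notin> B j" "basis \<I> (insert f (B j - {e}))"
      "basis \<I> (insert e (B i - {f}))"
      using symmetric_exchange[of "B j" "B i" e] assms(2) e i by metis
    define B' where "B' = B(i := insert e (B i - {f}), j := insert f (B j - {e}))"
    have B'i: "B' i = insert e (B i - {f})" using ij by (simp add: B'_def)
    have B'j: "B' j = insert f (B j - {e})" by (simp add: B'_def)
    have B'k: "B' k = B k" if "k \<noteq> i" "k \<noteq> j" for k using that by (simp add: B'_def)
    have bas: "basis \<I> (B' k)" if "k \<in> I" for k
      using f assms(2) that by (simp add: B'_def)
    \<comment> \<open>After the exchange \<open>e\<close> and \<open>f\<close> have swapped blocks
      and nothing else has moved; disjointness and the unchanged union are read off from
      this.\<close>
    have mem: "x \<in> B' k \<longleftrightarrow> (if x = e then k = i else if x = f then k = j else x \<in> B k)"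
      if "k \<in> I" for x k
      using disj[OF that e(2)] disj[OF that i(1)] e f B'i B'j B'k \<open>e \<notin> B i\<close> ij
      by (cases "k = i"; cases "k = j") auto
    have "disjoint_family_on B' I"
    proof (unfold disjoint_family_on_def, intro ballI impI)
      fix k l assume kl: "k \<in> I" "l \<in> I" "k \<noteq> l"
      show "B' k \<inter> B' l = {}"
        using mem[OF kl(1)] mem[OF kl(2)] disj[OF kl] kl(3) by (auto split: if_splits)
    qed
    moreover have "(\<Union>i\<in>I. B' i) = (\<Union>i\<in>I. B i)"
    proof (rule set_eqI)
      fix x show "x \<in> (\<Union>i\<in>I. B' i) \<longleftrightarrow> x \<in> (\<Union>i\<in>I. B i)"
        using mem e f i by (auto split: if_splits)
    qed
    moreover have "T \<inter> B' i = {e}" using Ti B'i e by auto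
    ultimately show ?thesis using that[of B' i] bas i by (auto simp: T_def U_def)
  qed
qed

text \<open>Splitting off a basis with one repeated element removes more elements than colours, so
  the surplus drops at least as fast as the number of bases. The final inclusion keeps the
  inductively obtained bases disjoint from the one split off.\<close>

lemma rainbow_bases_if_small_surplus:
  fixes B :: "'i \<Rightarrow> 'a set"
  assumes "finite I" "\<And>i. i \<in> I \<Longrightarrow> basis \<I> (B i)" "disjoint_family_on B I"
    and "card (\<Union>i\<in>I. B i) < card (c ` (\<Union>i\<in>I. B i)) + card I"
  shows "\<exists>B'. (\<forall>i\<in>I. rainbow_basis \<I> c (B' i)) \<and> disjoint_family_on B' I
    \<and> (\<Union>i\<in>I. B' i) \<subseteq> (\<Union>i\<in>I. B i)"
  using assms
proof (induction "card I" arbitrary: I B rule: less_induct)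
  case less
  define U where "U = (\<Union>i\<in>I. B i)"
  have finU: "finite U" using less.prems(1,2) finite_basis by (auto simp: U_def)
  show ?case
  proof (cases "repeated c U = {}")
    case True
    have "inj_on c (B i)" if "i \<in> I" for i
      using True that by (force simp: repeated_def U_def inj_on_def)
    then show ?thesis
      using less.prems by (intro exI[of _ B]) (auto simp: rainbow_basis_def)
  next
    case False
    obtain B' i where B': "\<And>i. i \<in> I \<Longrightarrow> basis \<I> (B' i)" "disjoint_family_on B' I"
      "(\<Union>i\<in>I. B' i) = U" "i \<in> I" "card (repeated c U \<inter> B' i) = 1"
      using exists_family_with_single_repeated[OF less.prems] False unfolding U_def by metis
    then obtain e where e: "repeated c U \<inter> B' i = {e}" by (auto simp: card_1_singleton_iff)
    define U' where "U' = (\<Union>k\<in>I - {i}. B' k)"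
    have UU': "U = B' i \<union> U'" "B' i \<inter> U' = {}"
      using B' by (auto simp: U'_def disjoint_family_on_def)
    have finBi: "finite (B' i)" using B' finite_basis by blast
    have finU': "finite U'" using UU' finU by simp
    have cU: "card U = card (B' i) + card U'"
      using UU' finBi finU' card_Un_disjoint by blast
    obtain y where y: "y \<in> U" "y \<noteq> e" "c y = c e" using e by (auto simp: repeated_def)
    \<comment> \<open>The chosen basis has no repeated element besides \<open>e\<close>, so the
      partner \<open>y\<close> lies in \<open>U'\<close> and the colour of \<open>e\<close> survives
      there.\<close>
    have "y \<in> repeated c U" using y e by (auto simp: repeated_def)
    then have "y \<in> U'" using y e UU' by auto
    then have "c e \<in> c ` U'" using y(3) by (metis imageI)
    then have "c ` U \<subseteq> c ` U' \<union> c ` (B' i - {e})" using UU'(1) by auto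
    then have "card (c ` U) \<le> card (c ` U') + card (c ` (B' i - {e}))"
      using finU' finBi by (meson card_Un_le card_mono finite_Diff finite_UnI finite_imageI le_trans)
    also have "card (c ` (B' i - {e})) \<le> card (B' i - {e})"
      using finBi by (intro card_image_le) auto
    also have "card (B' i - {e}) = card (B' i) - 1" using e finBi by (intro card_Diff_singleton) auto
    finally have cc: "card (c ` U) \<le> card (c ` U') + (card (B' i) - 1)" by simp
    have "0 < card (B' i)" using e finBi card_gt_0_iff by blast
    moreover have cI: "card I = Suc (card (I - {i}))"
      using B' less.prems(1) by (metis card_Suc_Diff1)
    ultimately have "card U' < card (c ` U') + card (I - {i})"
      using less.prems(4) cc cU unfolding U_def by linarith
    then have "\<exists>B''. (\<forall>k\<in>I - {i}. rainbow_basis \<I> c (B'' k)) \<and> disjoint_family_on B'' (I - {i})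
        \<and> (\<Union>k\<in>I - {i}. B'' k) \<subseteq> U'"
      unfolding U'_def
    proof (intro less.hyps)
      show "disjoint_family_on B' (I - {i})"
        using B'(2) by (rule disjoint_family_on_mono[rotated]) blast
    qed (use B'(1) cI less.prems(1) in simp_all)
    then obtain B'' where B'': "\<forall>k\<in>I - {i}. rainbow_basis \<I> c (B'' k)"
      "disjoint_family_on B'' (I - {i})" "(\<Union>k\<in>I - {i}. B'' k) \<subseteq> U'" by blast
    have injBi: "inj_on c (B' i)"
    proof (rule inj_onI)
      fix x z assume xz: "x \<in> B' i" "z \<in> B' i" "c x = c z"
      show "x = z"
      proof (rule ccontr)
        assume "x \<noteq> z"
        then have "x \<in> repeated c U" "z \<in> repeated c U"
          using xz UU' by (auto simp: repeated_def)
        then have "x \<in> {e}" "z \<in> {e}" using xz unfolding e[symmetric] by simp_all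
        then show False using \<open>x \<noteq> z\<close> by simp
      qed
    qed
    define C where "C = B''(i := B' i)"
    have "\<forall>k\<in>I. rainbow_basis \<I> c (C k)"
      using B'' B' injBi by (auto simp: C_def rainbow_basis_def)
    moreover have "disjoint_family_on C I"
    proof (unfold disjoint_family_on_def, intro ballI impI)
      fix k l assume kl: "k \<in> I" "l \<in> I" "k \<noteq> l"
      have "B'' k' \<inter> B' i = {}" if "k' \<in> I - {i}" for k' using B''(3) UU'(2) that by blast
      then show "C k \<inter> C l = {}"
        using B''(2) kl by (cases "k = i"; cases "l = i") (auto simp: C_def disjoint_family_on_def)
    qed
    moreover have "(\<Union>k\<in>I. C k) \<subseteq> U"
      using B''(3) UU' by (auto simp: C_def split: if_splits)
    ultimately show ?thesis unfolding U_def by blast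
  qed
qed

text \<open>Deleting a repeated element of a minimal \<open>U\<close> loses no colour, so it must
  destroy packability. The resulting tight set \<open>F\<close> contributes no surplus, and
  tightness gives the size of \<open>U - F\<close>.\<close>

lemma packable_with_small_surplus:
  assumes E: "packable t E" and "t > 0"
    and colours: "\<And>F. F \<subseteq> E \<Longrightarrow> r F + 2 \<le> r E \<Longrightarrow> card F + t * (r E - r F - 1) < card (c ` E)"
  obtains U where "packable t U" "card U < card (c ` U) + t"
proof -
  obtain U where U: "U \<subseteq> E" "packable t U \<and> c ` U = c ` E"
    "\<And>e. e \<in> U \<Longrightarrow> \<not> (packable t (U - {e}) \<and> c ` (U - {e}) = c ` E)"
    using finite_minimal_subset[of E "\<lambda>U. packable t U \<and> c ` U = c ` E"] finite_E E by blast
  have finU: "finite U" using finite_subset[OF U(1) finite_E] .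
  have "\<not> packable t (U - {e})" if e: "e \<in> repeated c U" for e
  proof -
    obtain y where "e \<in> U" "y \<in> U - {e}" "c y = c e" using e by (auto simp: repeated_def)
    then have "c ` (U - {e}) = c ` U"
      by (metis image_eqI image_insert insert_Diff insert_absorb)
    then show ?thesis using U \<open>e \<in> U\<close> by metis
  qed
  moreover have "repeated c U \<subseteq> U" by (auto simp: repeated_def)
  ultimately obtain F where F: "F \<subseteq> U" "F \<inter> repeated c U = {}" "card (U - F) = t * (r E - r F)"
    using tight_set_avoiding[of t U "repeated c U"] U by metis
  have finF: "finite F" using F finU finite_subset by blast
  have "inj_on c F" using F by (force simp: repeated_def inj_on_def)
  then have cF: "card (c ` F) = card F" by (rule card_image)
  have "c ` F \<inter> c ` (U - F) = {}"
  proof (rule ccontr)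
    assume "c ` F \<inter> c ` (U - F) \<noteq> {}"
    then obtain x y where "x \<in> F" "y \<in> U - F" "c x = c y" by auto
    then have "x \<in> repeated c U" using F(1) by (auto simp: repeated_def intro!: bexI[of _ y])
    then show False using F \<open>x \<in> F\<close> by blast
  qed
  moreover have "c ` U = c ` F \<union> c ` (U - F)" using F by auto
  ultimately have cU: "card (c ` U) = card F + card (c ` (U - F))"
    using cF finF finU by (simp add: card_Un_disjoint)
  have dU: "card U = card F + card (U - F)"
    using F finU finF by (metis card_Diff_subset card_mono le_add_diff_inverse)
  have "card (U - F) < card (c ` (U - F)) + t"
  proof -
    \<comment> \<open>The colour bound applies only when the ranks differ by at least 2. If they
      differ by 1, \<open>U - F\<close> has \<open>t\<close> elements and at least one colour; if
      they agree, it is empty.\<close>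
    consider "r F + 2 \<le> r E" | "r E - r F = 1" | "r E - r F = 0" by linarith
    then show ?thesis
    proof cases
      case 1
      have "t * (r E - r F) = t * (r E - r F - 1) + t"
        using 1 by (metis Suc_diff_Suc add.commute add_2_eq_Suc' diff_Suc_1 less_eq_Suc_le
            mult_Suc_right Suc_leD)
      moreover have "card F + t * (r E - r F - 1) < card (c ` U)"
        using colours[of F] F(1) U(1,2) 1 by auto
      ultimately show ?thesis using F(3) cU by linarith
    next
      case 2
      then have "U - F \<noteq> {}" using F \<open>t > 0\<close> by auto
      then have "0 < card (c ` (U - F))" using finU by (simp add: card_gt_0_iff)
      then show ?thesis using F 2 by simp
    next
      case 3
      then show ?thesis using F \<open>t > 0\<close> by simp
    qed
  qed
  then show ?thesis using that[of U] U cU dU by linarith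
qed

text \<open>The colour bound is assumed for all subsets because the tight set it is applied to need
  not be a flat.\<close>

lemma has_disjoint_rainbow_bases_if_many_colours:
  assumes "packable t E" and "t > 0"
    and "\<And>F. F \<subseteq> E \<Longrightarrow> r F + 2 \<le> r E \<Longrightarrow> card F + t * (r E - r F - 1) < card (c ` E)"
  shows "has_disjoint_rainbow_bases \<I> c t"
proof -
  obtain U where U: "packable t U" "card U < card (c ` U) + t"
    using packable_with_small_surplus[OF assms] by blast
  then have finU: "finite U" using finite_E finite_subset by (auto simp: packable_def)
  obtain B where B: "\<forall>i<t. basis \<I> (B i) \<and> B i \<subseteq> U" "disjoint_family_on B {..<t}"
    using disjoint_bases_if_packable[OF U(1)] by blast
  have "(\<Union>i<t. B i) \<subseteq> U" using B by auto
  then have "card (\<Union>i<t. B i) < card (c ` (\<Union>i<t. B i)) + card {..<t}"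
    using card_surplus_mono[OF finU, of "\<Union>i<t. B i" c] U(2) by simp
  then show ?thesis
    using rainbow_bases_if_small_surplus[of "{..<t}" B c] B
    unfolding has_disjoint_rainbow_bases_def by auto
qed

section \<open>Reduction to flats, and colourings without \<open>t\<close> disjoint rainbow
  bases\<close>

lemma packableI:
  assumes "\<not> (\<exists>F. flat E \<I> F \<and> card E - card F < t * (r E - r F))"
  shows "packable t E"
  unfolding packable_def
proof (intro conjI allI impI)
  fix S assume S: "S \<subseteq> E"
  have clE: "cl E \<I> S \<subseteq> E" by (auto simp: cl_def)
  \<comment> \<open>Replacing \<open>S\<close> by its closure keeps the rank and can only shrink the
    complement.\<close>
  have "t * (r E - r S) \<le> card E - card (cl E \<I> S)"
    using assms flat_cl[OF S] rank_cl[OF S] by (metis not_le_imp_less)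
  also have "\<dots> \<le> card E - card S"
    using subset_cl[OF S] clE finite_E by (meson card_mono diff_le_mono2 finite_subset)
  also have "\<dots> = card (E - S)" using S finite_E by (metis card_Diff_subset finite_subset)
  finally show "t * (r E - r S) \<le> card (E - S)" .
qed simp

text \<open>Disjoint bases would need \<open>t * (r E - r F)\<close> elements outside
  \<open>F\<close>. The colouring is arbitrary, so even an injective one is covered.\<close>

lemma no_disjoint_bases:
  assumes "F \<subseteq> E" "card E - card F < t * (r E - r F)"
  shows "\<not> has_disjoint_rainbow_bases \<I> c t"
proof
  assume "has_disjoint_rainbow_bases \<I> c t"
  then obtain B where B: "\<And>i. i < t \<Longrightarrow> basis \<I> (B i)" "disjoint_family_on B {..<t}"
    by (auto simp: has_disjoint_rainbow_bases_def rainbow_basis_def)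
  have "t * (r E - r F) \<le> (\<Sum>i<t. card (B i - F))"
    using sum_bounded_below[of "{..<t}" "r E - r F" "\<lambda>i. card (B i - F)"] card_basis_diff B by simp
  also have "\<dots> = card (\<Union>i<t. B i - F)"
    using B finite_basis by (intro card_UN_disjoint'[symmetric]) (auto simp: disjoint_family_on_def)
  also have "\<dots> \<le> card (E - F)"
    using B basis_subset_E finite_E by (intro card_mono) auto
  also have "\<dots> = card E - card F" using assms finite_E by (metis card_Diff_subset finite_subset)
  finally show False using assms by simp
qed

text \<open>The extremal colouring: all of \<^term>\<open>F\<close> and all but one colour class outside it are
  singletons, so every rainbow basis uses at least \<^term>\<open>r E - r F - 1\<close> of the
  \<^term>\<open>t * (r E - r F - 1) - 1\<close> singletons outside \<^term>\<open>F\<close>.\<close>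

lemma extremal_colouring:
  assumes "packable t E" "t > 0" "F \<subseteq> E" "r F + 2 \<le> r E"
  obtains c :: "'a \<Rightarrow> nat" where "card (c ` E) = card F + t * (r E - r F - 1)"
    "\<not> has_disjoint_rainbow_bases \<I> c t"
proof -
  define k where "k = r E - r F - 1"
  have k: "k > 0" "r E - r F = Suc k" using assms(4) by (auto simp: k_def)
  have finF: "finite F" using assms finite_E finite_subset by blast
  have tk: "0 < t * k" using k assms by simp
  have big: "t * k < card (E - F)"
  proof -
    have "t * Suc k \<le> card (E - F)" using assms k by (auto simp: packable_def)
    then show ?thesis using \<open>t > 0\<close> by simp
  qed
  then have "t * k - 1 \<le> card (E - F)" by simp
  \<comment> \<open>One element short of \<open>t * k\<close>: together with the shared colour this
    gives exactly \<open>t * k\<close> colours outside \<open>F\<close>.\<close>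
  then obtain S where S: "S \<subseteq> E - F" "card S = t * k - 1" "finite S"
    by (rule obtain_subset_with_card_n)
  obtain g :: "'a \<Rightarrow> nat" where g: "inj_on g E" "g ` E = {0..<card E}"
    using ex_bij_betw_finite_nat[OF finite_E] by (auto simp: bij_betw_def)
  \<comment> \<open>The values of \<open>g\<close> on \<open>E\<close> are below
    \<open>card E\<close>, so \<open>card E\<close> is a fresh colour; the element \<open>z\<close>
    below shows that it occurs.\<close>
  define c where "c x = (if x \<in> F \<union> S then g x else card E)" for x
  have "E - F - S \<noteq> {}" using S big tk
    by (metis Diff_eq_empty_iff S(3) card_mono diff_le_self leD le_trans)
  then obtain z where z: "z \<in> E" "z \<notin> F \<union> S" by blast
  have FSE: "F \<union> S \<subseteq> E" using assms S by auto
  have "c ` E = insert (card E) (g ` (F \<union> S))"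
    using z FSE by (auto simp: c_def image_iff)
  moreover have "card E \<notin> g ` (F \<union> S)" using g(2) FSE by fastforce
  ultimately have "card (c ` E) = Suc (card (g ` (F \<union> S)))" using finF S by simp
  also have "card (g ` (F \<union> S)) = card (F \<union> S)"
    using g FSE by (intro card_image) (rule inj_on_subset)
  also have "card (F \<union> S) = card F + card S" using S finF by (intro card_Un_disjoint) auto
  finally have "card (c ` E) = card F + t * k" using S tk by simp
  moreover have "\<not> has_disjoint_rainbow_bases \<I> c t"
  proof
    assume "has_disjoint_rainbow_bases \<I> c t"
    then obtain B where B: "\<And>i. i < t \<Longrightarrow> basis \<I> (B i)" "\<And>i. i < t \<Longrightarrow> inj_on c (B i)"
      "disjoint_family_on B {..<t}"
      by (auto simp: has_disjoint_rainbow_bases_def rainbow_basis_def)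
    have "k \<le> card (B i \<inter> S)" if i: "i < t" for i
    proof -
      have finB: "finite (B i)" using B(1)[OF i] finite_basis by blast
      have "Suc k \<le> card (B i - F)" using card_basis_diff[OF B(1)[OF i], of F] k by simp
      also have "\<dots> = card ((B i - F) \<inter> S) + card ((B i - F) - S)"
        using finB card_Int_Diff by blast
      also have "(B i - F) \<inter> S = B i \<inter> S" using S by auto
      \<comment> \<open>Everything outside \<open>F \<union> S\<close> has the same colour.\<close>
      also have "card ((B i - F) - S) \<le> 1"
      proof -
        have "inj_on c (B i - F - S)" using B(2)[OF i] by (rule inj_on_subset) auto
        then have "card (B i - F - S) = card (c ` (B i - F - S))" by (simp add: card_image)
        also have "\<dots> \<le> card {card E}" by (intro card_mono) (auto simp: c_def)
        finally show ?thesis by simp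
      qed
      finally show ?thesis by simp
    qed
    then have "t * k \<le> (\<Sum>i<t. card (B i \<inter> S))"
      using sum_bounded_below[of "{..<t}" k "\<lambda>i. card (B i \<inter> S)"] by simp
    also have "\<dots> = card (\<Union>i<t. B i \<inter> S)"
    proof (intro card_UN_disjoint'[symmetric])
      show "disjoint_family_on (\<lambda>i. B i \<inter> S) {..<t}"
        using B(3) unfolding disjoint_family_on_def by blast
    qed (use S in auto)
    also have "\<dots> \<le> card S" using S by (intro card_mono) auto
    finally show False using S(2) tk by linarith
  qed
  ultimately show ?thesis using that by (simp add: k_def)
qed

end

theorem theorem3:
  fixes E :: "'a set" and \<I> :: "'a set set" and t :: nat
  assumes "matroid E \<I>"
    and "rank \<I> E \<ge> 2"
    and "t > 0"
  shows "((\<exists>F. flat E \<I> F \<and> card E - card F < t * (rank \<I> E - rank \<I> F))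
            \<longrightarrow> ar E \<I> t = card E) \<and>
         (\<not> (\<exists>F. flat E \<I> F \<and> card E - card F < t * (rank \<I> E - rank \<I> F))
            \<longrightarrow> ar E \<I> t =
                Max {card F + t * (rank \<I> E - rank \<I> F - 1) | F.
                       flat E \<I> F \<and> rank \<I> F \<le> rank \<I> E - 2})"
proof -
  interpret finite_matroid E \<I> using assms(1) by unfold_locales
  define A where "A = {m. \<exists>c :: 'a \<Rightarrow> nat. card (c ` E) = m \<and> \<not> has_disjoint_rainbow_bases \<I> c t}"
  define V where "V = {card F + t * (rank \<I> E - rank \<I> F - 1) | F.
                       flat E \<I> F \<and> rank \<I> F \<le> rank \<I> E - 2}"
  have ar: "ar E \<I> t = Max A" by (simp add: ar_def A_def)
  have A_le: "m \<le> card E" if "m \<in> A" for m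
    using that finite_E card_image_le by (auto simp: A_def)
  then have finA: "finite A" by (meson finite_nat_set_iff_bounded_le)
  have "ar E \<I> t = card E" if "flat E \<I> F" "card E - card F < t * (r E - r F)" for F
  proof -
    \<comment> \<open>An injective colouring attains the trivial upper bound
      \<open>card E\<close>.\<close>
    obtain g :: "'a \<Rightarrow> nat" where "inj_on g E"
      using finite_imp_inj_to_nat_seg[OF finite_E] by blast
    then have "card E \<in> A"
      using no_disjoint_bases[of F t g] that card_image by (force simp: A_def flat_def)
    then show ?thesis unfolding ar using finA A_le by (intro Max_eqI)
  qed
  moreover have "ar E \<I> t = Max V"
    if "\<not> (\<exists>F. flat E \<I> F \<and> card E - card F < t * (r E - r F))"
  proof -
    have pack: "packable t E" using packableI[OF that] .
    have VA: "V \<subseteq> A"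
    proof
      fix m assume "m \<in> V"
      then obtain F where F: "flat E \<I> F" "r F \<le> r E - 2" "m = card F + t * (r E - r F - 1)"
        by (auto simp: V_def)
      \<comment> \<open>Rank at least 2 makes the natural-number subtraction \<open>r E - 2\<close>
        exact.\<close>
      then have "F \<subseteq> E" "r F + 2 \<le> r E" using assms(2) by (auto simp: flat_def)
      then show "m \<in> A"
        using extremal_colouring[OF pack assms(3), of F] F by (auto simp: A_def)
    qed
    \<comment> \<open>The closure of the empty set is an admissible flat, so \<open>Max V\<close> is
      a genuine maximum.\<close>
    have "flat E \<I> (cl E \<I> {})" "r (cl E \<I> {}) = 0"
      using flat_cl[of "{}"] rank_cl[of "{}"] rank_empty by auto
    then have Vne: "V \<noteq> {}" by (fastforce simp: V_def)
    have finV: "finite V" using VA finA finite_subset by blast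
    have "m \<le> Max V" if mA: "m \<in> A" for m
    proof (rule ccontr)
      assume m: "\<not> m \<le> Max V"
      obtain c :: "'a \<Rightarrow> nat" where c: "card (c ` E) = m" "\<not> has_disjoint_rainbow_bases \<I> c t"
        using mA by (auto simp: A_def)
      \<comment> \<open>The closure has the same rank and at least as many elements, so the bound
        for flats extends to all subsets.\<close>
      have "card S + t * (r E - r S - 1) < card (c ` E)" if S: "S \<subseteq> E" "r S + 2 \<le> r E" for S
      proof -
        have "card (cl E \<I> S) + t * (r E - r S - 1) \<in> V"
          unfolding V_def using flat_cl[OF S(1)] rank_cl[OF S(1)] S(2)
          by (intro CollectI exI[of _ "cl E \<I> S"]) auto
        then have "card (cl E \<I> S) + t * (r E - r S - 1) \<le> Max V" using finV by simp
        moreover have "card S \<le> card (cl E \<I> S)"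
          using subset_cl[OF S(1)] finite_E by (intro card_mono) (auto simp: cl_def)
        ultimately show ?thesis using c m by linarith
      qed
      then show False
        using has_disjoint_rainbow_bases_if_many_colours[OF pack assms(3)] c(2) by blast
    qed
    then show ?thesis unfolding ar using finA VA finV Vne by (intro Max_eqI) (auto intro: Max_in)
  qed
  ultimately show ?thesis unfolding V_def by blast
qed

end
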